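(* Let $1\le d\le n$ and let $X_1,\dots,X_n$ be independent bounded real random variables with $\mathbb{E}X_i=0$ and $\mathbb{E}X_i^2=1$ for all $i=1,\dots,n$. Let $f(X)$ be a multilinear polynomial of the form $f=\sum_{k=d}^n f_k$, where $$f_k=\sum_{1\le i_1<\dots<i_k\le n}\alpha_{i_1\dots i_k}X_{i_1}\cdots X_{i_k},\qquad \alpha_{i_1\dots i_k}\in\mathbb{R}.$$ If $\lVert \mathfrak{h}^{(d)}f\rVert_{\mathrm{HS},\infty}\le 1$, then $\lVert\mathfrak{h}^{(k)}f\rVert_{\mathrm{HS},2}\le 1$ for all $k=1,\dots,d-1$.
   Context: Let $X=(X_1,\dots,X_n)$ and let $(\bar X_1,\dots,\bar X_n)$ be an independent copy of $X$. For Borel $f:\mathbb{R}^n\to\mathbb{R}$ with $f(X)\in L^\infty(\mathbb{P})$ write $T_if=f(X_1,\dots,X_{i-1},\bar X_i,X_{i+1},\dots,X_n)$. For indices $i_1,\dots,i_k$ put $$\mathfrak{h}_{i_1\dots i_k}f(X)=\frac1{2^k}\Big\lVert \prod_{s=1}^k(Id-T_{i_s})f(X)\Big\rVert_{i_1,\dots,i_k,\infty},$$ where $\lVert\cdot\rVert_{i_1,\dots,i_k,\infty}$ is the $L^\infty$-norm (essential supremum of the absolute value) with respect to $X_{i_1},\dots,X_{i_k},\bar X_{i_1},\dots,\bar X_{i_k}$, the other coordinates $X_j$ being kept fixed. The hypermatrix $\mathfrak{h}^{(k)}f$ has entries $\mathfrak{h}_{i_1\dots i_k}f(X)$ if $i_1,\dots,i_k\in\{1,\dots,n\}$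 are pairwise distinct and $0$ otherwise. $|\mathfrak{h}^{(k)}f|_{\mathrm{HS}}$ is its Euclidean norm in $\mathbb{R}^{n^k}$, and $\lVert \mathfrak{h}^{(k)}f\rVert_{\mathrm{HS},p}=(\mathbb{E}|\mathfrak{h}^{(k)}f|_{\mathrm{HS}}^p)^{1/p}$ for $0<p<\infty$, with the $L^\infty(\mathbb{P})$-norm for $p=\infty$. *)

theory Defs
  imports "HOL-Probability.Probability" "HOL-Probability.Essential_Supremum"
begin

text \<open>
  Points of \<open>\<real>\<^sup>n\<close> are the functions in \<open>space (\<Pi>\<^sub>M i\<in>{1..n}. borel)\<close>, i.e. functions on
  \<open>nat\<close> that are \<open>undefined\<close> outside \<open>{1..n}\<close>; a multi-index \<open>i\<^sub>1\<dots>i\<^sub>k\<close> is a list of length \<open>k\<close>.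
\<close>

abbreviation RR :: "nat \<Rightarrow> (nat \<Rightarrow> real) measure" where
  "RR n \<equiv> (\<Pi>\<^sub>M i\<in>{1..n}. (borel :: real measure))"

definition rvec :: "nat \<Rightarrow> (nat \<Rightarrow> 'a \<Rightarrow> real) \<Rightarrow> 'a \<Rightarrow> nat \<Rightarrow> real" where
  "rvec n X \<omega> = (\<lambda>i\<in>{1..n}. X i \<omega>)"

definition independent_copy ::
  "'a measure \<Rightarrow> nat \<Rightarrow> (nat \<Rightarrow> 'a \<Rightarrow> real) \<Rightarrow> (nat \<Rightarrow> 'a \<Rightarrow> real) \<Rightarrow> bool" where
  "independent_copy M n X Xb \<longleftrightarrow>
     prob_space.indep_var M (RR n) (rvec n X) (RR n) (rvec n Xb) \<and>
     distr M (RR n) (rvec n Xb) = distr M (RR n) (rvec n X)"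

text \<open>
  The operators act on functions \<open>F x xb\<close> of a point \<open>x\<close> and a value \<open>xb\<close> of the independent copy,
  since products of several \<open>Id - T\<^sub>i\<close> produce functions of both.
\<close>

definition T_op :: "nat \<Rightarrow> ((nat \<Rightarrow> real) \<Rightarrow> (nat \<Rightarrow> real) \<Rightarrow> real) \<Rightarrow>
    (nat \<Rightarrow> real) \<Rightarrow> (nat \<Rightarrow> real) \<Rightarrow> real" where
  "T_op i F = (\<lambda>x xb. F (x(i := xb i)) xb)"

definition Id_minus_T :: "nat \<Rightarrow> ((nat \<Rightarrow> real) \<Rightarrow> (nat \<Rightarrow> real) \<Rightarrow> real) \<Rightarrow>
    (nat \<Rightarrow> real) \<Rightarrow> (nat \<Rightarrow> real) \<Rightarrow> real" where
  "Id_minus_T i F = (\<lambda>x xb. F x xb - T_op i F x xb)"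

definition prod_Id_minus_T :: "nat list \<Rightarrow> ((nat \<Rightarrow> real) \<Rightarrow> real) \<Rightarrow>
    (nat \<Rightarrow> real) \<Rightarrow> (nat \<Rightarrow> real) \<Rightarrow> real" where
  "prod_Id_minus_T is f = foldr Id_minus_T is (\<lambda>x xb. f x)"

text \<open>
  The \<open>L\<^sup>\<infinity>\<close>-norm in \<open>X\<^sub>i, Xb\<^sub>i\<close> for \<open>i\<close> in \<open>set is\<close> at a point \<open>x\<close>: these coordinates are random,
  the other ones keep their values from \<open>x\<close>.
\<close>

definition h_entry :: "'a measure \<Rightarrow> nat \<Rightarrow> (nat \<Rightarrow> 'a \<Rightarrow> real) \<Rightarrow> (nat \<Rightarrow> 'a \<Rightarrow> real) \<Rightarrow>
    ((nat \<Rightarrow> real) \<Rightarrow> real) \<Rightarrow> nat list \<Rightarrow> (nat \<Rightarrow> real) \<Rightarrow> ennreal" where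
  "h_entry M n X Xb f is x =
     ennreal (1 / 2 ^ length is) *
     esssup M (\<lambda>\<omega>. ennreal \<bar>prod_Id_minus_T is f
       (override_on x (rvec n X \<omega>) (set is)) (rvec n Xb \<omega>)\<bar>)"

definition h_hypermatrix :: "'a measure \<Rightarrow> nat \<Rightarrow> (nat \<Rightarrow> 'a \<Rightarrow> real) \<Rightarrow> (nat \<Rightarrow> 'a \<Rightarrow> real) \<Rightarrow>
    ((nat \<Rightarrow> real) \<Rightarrow> real) \<Rightarrow> (nat \<Rightarrow> real) \<Rightarrow> nat list \<Rightarrow> ennreal" where
  "h_hypermatrix M n X Xb f x is = (if distinct is then h_entry M n X Xb f is x else 0)"

text \<open>Only meant for exponents \<open>p > 0\<close>.\<close>

definition ennreal_powr :: "ennreal \<Rightarrow> real \<Rightarrow> ennreal" where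
  "ennreal_powr x p = (if x = \<infinity> then \<infinity> else ennreal (enn2real x powr p))"

definition HS_norm :: "nat \<Rightarrow> nat \<Rightarrow> (nat list \<Rightarrow> ennreal) \<Rightarrow> ennreal" where
  "HS_norm n k A = ennreal_powr (\<Sum>is | length is = k \<and> set is \<subseteq> {1..n}. (A is)\<^sup>2) (1 / 2)"

definition Lp_norm :: "'a measure \<Rightarrow> ennreal \<Rightarrow> ('a \<Rightarrow> ennreal) \<Rightarrow> ennreal" where
  "Lp_norm M p g = (if p = \<infinity> then esssup M g
     else ennreal_powr (\<integral>\<^sup>+\<omega>. ennreal_powr (g \<omega>) (enn2real p) \<partial>M) (1 / enn2real p))"

definition h_HS_norm :: "'a measure \<Rightarrow> nat \<Rightarrow> (nat \<Rightarrow> 'a \<Rightarrow> real) \<Rightarrow> (nat \<Rightarrow> 'a \<Rightarrow> real) \<Rightarrow>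
    ((nat \<Rightarrow> real) \<Rightarrow> real) \<Rightarrow> nat \<Rightarrow> ennreal \<Rightarrow> ennreal" where
  "h_HS_norm M n X Xb f k p =
     Lp_norm M p (\<lambda>\<omega>. HS_norm n k (h_hypermatrix M n X Xb f (rvec n X \<omega>)))"

definition f_hom :: "nat \<Rightarrow> (nat list \<Rightarrow> real) \<Rightarrow> nat \<Rightarrow> (nat \<Rightarrow> real) \<Rightarrow> real" where
  "f_hom n \<alpha> k x =
     (\<Sum>is | length is = k \<and> set is \<subseteq> {1..n} \<and> sorted_wrt (<) is. \<alpha> is * (\<Prod>i\<leftarrow>is. x i))"

definition f_poly :: "nat \<Rightarrow> nat \<Rightarrow> (nat list \<Rightarrow> real) \<Rightarrow> (nat \<Rightarrow> real) \<Rightarrow> real" where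
  "f_poly n d \<alpha> x = (\<Sum>k=d..n. f_hom n \<alpha> k x)"

end

theory Submission
  imports Defs
begin

text \<open>
  Each mixed difference factors as
  \<open>\<Prod>\<^sub>i\<^sub>\<in>\<^sub>I (Id - T\<^sub>i) f = (\<Prod>\<^sub>i\<^sub>\<in>\<^sub>I (X\<^sub>i - Xb\<^sub>i)) \<cdot> \<partial>\<^sub>I f\<close>, so by orthonormality of the monomials
  the squared \<open>L\<^sup>2\<close> norm of the \<open>k\<close>-th hypermatrix is \<open>\<Sum>\<^sub>J \<alpha>\<^sub>J\<^sup>2 w\<^sub>k(J)\<close> over \<open>|J| \<ge> d\<close>, where \<open>w\<^sub>k(J)\<close> sums
  \<open>\<parallel>\<Prod>\<^sub>i\<^sub>\<in>\<^sub>I (X\<^sub>i - Xb\<^sub>i) / 2\<parallel>\<^sub>\<infinity>\<^sup>2\<close> over the injective \<open>k\<close>-tuples \<open>I\<close> in \<open>J\<close>.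
  A centred variable of variance 1 oscillates by at least 2 (Popoviciu), so by independence adding
  an index to \<open>I\<close> does not decrease this norm. Hence \<open>w\<^sub>k(J) \<le> w\<^sub>d(J)\<close> for \<open>k \<le> d \<le> |J|\<close>, and the
  \<open>L\<^sup>2\<close> norm at level \<open>d\<close> is at most the \<open>L\<^sup>\<infinity>\<close> norm.
\<close>

section \<open>The range of a standardized random variable\<close>

text \<open>Taking expectations in (b - X)(X - a) \<ge> 0 gives ab \<le> -1, and then (b - a)^2 = (a
  + b)^2 - 4ab is at least 4.\<close>

lemma (in prob_space) Popoviciu_standardized:
  fixes X :: "'a \<Rightarrow> real"
  assumes [measurable]: "random_variable borel X"
    and bnd: "AE \<omega> in M. a \<le> X \<omega> \<and> X \<omega> \<le> b"
    and "expectation X = 0" and "expectation (\<lambda>\<omega>. (X \<omega>)\<^sup>2) = 1"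
  shows "2 \<le> b - a"
proof -
  have int: "integrable M X"
    using bnd by (intro integrable_const_bound[of _ "\<bar>a\<bar> + \<bar>b\<bar>"]) auto
  \<comment> \<open>The integral of a non-integrable function is 0 by convention, so the value 1
    forces integrability.\<close>
  have int2: "integrable M (\<lambda>\<omega>. (X \<omega>)\<^sup>2)"
  proof (rule ccontr)
    assume "\<not> ?thesis"
    then show False using assms(4) by (simp add: not_integrable_integral_eq)
  qed
  have "0 \<le> expectation (\<lambda>\<omega>. (b - X \<omega>) * (X \<omega> - a))"
    using bnd by (intro integral_nonneg_AE) auto
  also have "(\<lambda>\<omega>. (b - X \<omega>) * (X \<omega> - a)) = (\<lambda>\<omega>. (a + b) * X \<omega> - (X \<omega>)\<^sup>2 - a * b)"
    by (auto simp: algebra_simps power2_eq_square)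
  also have "expectation \<dots> = - 1 - a * b"
    using int int2 assms(3,4) by (simp add: prob_space)
  finally have ab: "a * b \<le> - 1" by simp
  have "2\<^sup>2 \<le> (b - a)\<^sup>2"
    using ab zero_le_power2[of "a + b"] by (simp add: power2_eq_square algebra_simps)
  \<comment> \<open>An almost sure statement that does not involve the sample point is true, because
    the whole space has probability 1.\<close>
  moreover have "AE \<omega> in M. a \<le> b"
    using bnd by eventually_elim simp
  then have "a \<le> b"
    by simp
  ultimately show ?thesis
    using power2_le_imp_le[of 2 "b - a"] by simp
qed

text \<open>\<open>A\<close> collects the reals within \<open>D\<close> of almost every value of
  \<open>X\<close>, and \<open>X\<close> lies in \<open>A\<close> almost surely. The interval runs
  from \<open>Sup A - D\<close> to \<open>Sup A\<close>: the upper bound is membership in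
  \<open>A\<close>, and the lower one comes from letting u in \<open>A\<close> approach the supremum
  in X \<ge> u - D.\<close>

lemma (in prob_space) AE_diff_bounded_imp_AE_interval:
  fixes X :: "'a \<Rightarrow> real"
  assumes D: "AE \<omega> in M. AE \<omega>' in M. \<bar>X \<omega> - X \<omega>'\<bar> \<le> D"
  obtains a where "AE \<omega> in M. a \<le> X \<omega> \<and> X \<omega> \<le> a + D"
proof -
  define A where "A = {u. AE \<omega> in M. \<bar>u - X \<omega>\<bar> \<le> D}"
  have XA: "AE \<omega> in M. X \<omega> \<in> A"
    using D by (simp add: A_def)
  then obtain u0 where u0: "u0 \<in> A"
    by (metis (lifting) ae_filter_bot eventually_happens)
  have bdd: "bdd_above A"
  proof (rule bdd_aboveI)
    fix u assume "u \<in> A"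
    then have "AE \<omega> in M. u \<le> u0 + 2 * D"
      using u0 unfolding A_def mem_Collect_eq by eventually_elim linarith
    then show "u \<le> u0 + 2 * D" by simp
  qed
  \<comment> \<open>The supremum is approached along a sequence, so that only countably many null
    sets have to be united.\<close>
  have "AE \<omega> in M. Sup A - 1 / real (Suc m) \<le> X \<omega> + D" for m
  proof -
    obtain u where "u \<in> A" "Sup A - 1 / real (Suc m) < u"
      using less_cSupD[of A "Sup A - 1 / real (Suc m)"] u0 by auto
    then show ?thesis
      unfolding A_def mem_Collect_eq by (elim eventually_mono) linarith
  qed
  then have "AE \<omega> in M. \<forall>m. Sup A - 1 / real (Suc m) \<le> X \<omega> + D"
    by (simp add: AE_all_countable)
  then have "AE \<omega> in M. Sup A - D \<le> X \<omega> \<and> X \<omega> \<le> (Sup A - D) + D"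
    using XA
  proof eventually_elim
    case (elim \<omega>)
    have "(\<lambda>m. Sup A - 1 / real (Suc m)) \<longlonglongrightarrow> Sup A - 0"
      by (intro tendsto_intros LIMSEQ_Suc[OF lim_1_over_n])
    then have "Sup A - 0 \<le> X \<omega> + D"
      by (rule LIMSEQ_le_const2) (use elim in auto)
    then show ?case using cSup_upper[OF elim(2) bdd] by simp
  qed
  then show thesis by (rule that)
qed

section \<open>Consequences of independence\<close>

text \<open>The joint law of independent variables is the product of their laws, so Fubini for null
  sets lets \<open>Y\<close> be sampled afresh while \<open>X\<close> is frozen.\<close>

lemma (in prob_space) AE_indep_varD:
  assumes ind: "indep_var S X T Y" and P: "Measurable.pred (S \<Otimes>\<^sub>M T) (\<lambda>p. P (fst p) (snd p))"
    and ae: "AE \<omega> in M. P (X \<omega>) (Y \<omega>)"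
  shows "AE \<omega> in M. AE \<omega>' in M. P (X \<omega>) (Y \<omega>')"
proof -
  note [measurable] = indep_var_rv1[OF ind] indep_var_rv2[OF ind]
  interpret SX: prob_space "distr M S X" by (rule prob_space_distr) measurable
  interpret TY: prob_space "distr M T Y" by (rule prob_space_distr) measurable
  interpret P: pair_prob_space "distr M S X" "distr M T Y" ..
  have "AE p in distr M (S \<Otimes>\<^sub>M T) (\<lambda>\<omega>. (X \<omega>, Y \<omega>)). P (fst p) (snd p)"
    using P ae by (subst AE_distr_iff) auto
  then have "AE p in distr M S X \<Otimes>\<^sub>M distr M T Y. P (fst p) (snd p)"
    by (simp only: indep_var_distribution_eq[THEN iffD1, OF ind, THEN conjunct2, THEN conjunct2])
  then have "AE x in distr M S X. AE y in distr M T Y. P x y"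
    by (auto dest: P.AE_pair)
  then have "AE \<omega> in M. AE y in distr M T Y. P (X \<omega>) y"
    by (rule AE_distrD[rotated]) measurable
  then show ?thesis
    by (elim eventually_mono) (rule AE_distrD[of Y M T], auto)
qed

text \<open>Independence is tested on boxes: the probability factors first between the two random
  vectors and then within each of them. The Boolean tag tells which family a variable comes
  from.\<close>

lemma (in prob_space) indep_vars_pair:
  fixes X Y :: "'i \<Rightarrow> 'a \<Rightarrow> 'b :: topological_space"
  assumes X: "indep_vars (\<lambda>_. borel) X I" and Y: "indep_vars (\<lambda>_. borel) Y I"
    and XY: "indep_var (\<Pi>\<^sub>M i\<in>I. borel) (\<lambda>\<omega>. \<lambda>i\<in>I. X i \<omega>) (\<Pi>\<^sub>M i\<in>I. borel) (\<lambda>\<omega>. \<lambda>i\<in>I. Y i \<omega>)"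
    and I: "finite I" "I \<noteq> {}"
  shows "indep_vars (\<lambda>_. borel) (\<lambda>(b, i). if b then X i else Y i) (UNIV \<times> I)"
proof -
  have rv: "\<And>i. i \<in> I \<Longrightarrow> random_variable borel (X i)" "\<And>i. i \<in> I \<Longrightarrow> random_variable borel (Y i)"
    using X Y by (auto simp: indep_vars_def)
  show ?thesis
  proof (subst indep_vars_finite[where E="\<lambda>_. sets borel"]; (intro ballI)?)
    fix A :: "bool \<times> 'i \<Rightarrow> 'b set"
    assume A: "A \<in> UNIV \<times> I \<rightarrow> sets borel"
    let ?E = "\<lambda>b. Pi\<^sub>E I (\<lambda>i. A (b, i))"
    have E: "?E b \<in> sets (\<Pi>\<^sub>M i\<in>I. borel)" for b
      using A I by (intro sets_PiM_I_finite) auto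
    have "prob (\<Inter>j\<in>UNIV \<times> I. (case j of (b, i) \<Rightarrow> if b then X i else Y i) -` A j \<inter> space M)
      = prob ((\<lambda>\<omega>. (\<lambda>i\<in>I. X i \<omega>, \<lambda>i\<in>I. Y i \<omega>)) -` (?E True \<times> ?E False) \<inter> space M)"
    proof (intro arg_cong[where f=prob] set_eqI)
      fix \<omega>
      \<comment> \<open>With no index at hand, the quantified condition would be vacuous and would
        not yield membership in \<open>space M\<close>.\<close>
      obtain i where "i \<in> I" using I by blast
      have "\<omega> \<in> (\<Inter>j\<in>UNIV \<times> I. (case j of (b, i) \<Rightarrow> if b then X i else Y i) -` A j \<inter> space M) \<longleftrightarrow>
          (\<forall>b. \<forall>i\<in>I. (if b then X i else Y i) \<omega> \<in> A (b, i) \<and> \<omega> \<in> space M)"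
        by auto
      also have "\<dots> \<longleftrightarrow> \<omega> \<in> space M \<and> (\<forall>i\<in>I. X i \<omega> \<in> A (True, i)) \<and> (\<forall>i\<in>I. Y i \<omega> \<in> A (False, i))"
        unfolding all_bool_eq using \<open>i \<in> I\<close> by auto
      also have "\<dots> \<longleftrightarrow> \<omega> \<in> (\<lambda>\<omega>. (\<lambda>i\<in>I. X i \<omega>, \<lambda>i\<in>I. Y i \<omega>)) -` (?E True \<times> ?E False) \<inter> space M"
        by (auto simp: PiE_iff)
      finally show "\<omega> \<in> (\<Inter>j\<in>UNIV \<times> I. (case j of (b, i) \<Rightarrow> if b then X i else Y i) -` A j \<inter> space M) \<longleftrightarrow>
        \<omega> \<in> (\<lambda>\<omega>. (\<lambda>i\<in>I. X i \<omega>, \<lambda>i\<in>I. Y i \<omega>)) -` (?E True \<times> ?E False) \<inter> space M" .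
    qed
    also have "\<dots> = prob ((\<lambda>\<omega>. \<lambda>i\<in>I. X i \<omega>) -` ?E True \<inter> space M) *
        prob ((\<lambda>\<omega>. \<lambda>i\<in>I. Y i \<omega>) -` ?E False \<inter> space M)"
      by (rule indep_varD[OF XY E E])
    also have "(\<lambda>\<omega>. \<lambda>i\<in>I. X i \<omega>) -` ?E True \<inter> space M = (\<Inter>i\<in>I. X i -` A (True, i) \<inter> space M)"
      using I by (auto simp: PiE_iff)
    also have "prob \<dots> = (\<Prod>i\<in>I. prob (X i -` A (True, i) \<inter> space M))"
      using A I by (intro indep_varsD[OF X]) auto
    also have "(\<lambda>\<omega>. \<lambda>i\<in>I. Y i \<omega>) -` ?E False \<inter> space M = (\<Inter>i\<in>I. Y i -` A (False, i) \<inter> space M)"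
      using I by (auto simp: PiE_iff)
    also have "prob \<dots> = (\<Prod>i\<in>I. prob (Y i -` A (False, i) \<inter> space M))"
      using A I by (intro indep_varsD[OF Y]) auto
    also have "(\<Prod>i\<in>I. prob (X i -` A (True, i) \<inter> space M)) * (\<Prod>i\<in>I. prob (Y i -` A (False, i) \<inter> space M))
      = (\<Prod>b\<in>UNIV. \<Prod>i\<in>I. prob ((if b then X i else Y i) -` A (b, i) \<inter> space M))"
      by (simp add: UNIV_bool mult.commute)
    also have "\<dots> = (\<Prod>j\<in>UNIV \<times> I. prob ((case j of (b, i) \<Rightarrow> if b then X i else Y i) -` A j \<inter> space M))"
      unfolding prod.cartesian_product by (rule prod.cong) auto
    finally show "prob (\<Inter>j\<in>UNIV \<times> I. (case j of (b, i) \<Rightarrow> if b then X i else Y i) -` A j \<inter> space M)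
      = (\<Prod>j\<in>UNIV \<times> I. prob ((case j of (b, i) \<Rightarrow> if b then X i else Y i) -` A j \<inter> space M))" .
  qed (use I rv in \<open>auto simp: Int_stable_def sets.sigma_sets_eq[of borel, simplified] split: if_splits\<close>)
qed

section \<open>Differences of multilinear polynomials\<close>

text \<open>This is the mixed partial derivative, in the variables indexed by \<open>I\<close>, of
  the multilinear polynomial with supports in \<open>F\<close> and coefficients \<open>a\<close>.
  For empty \<open>I\<close> it is the polynomial itself.\<close>

definition mpartial :: "nat set set \<Rightarrow> (nat set \<Rightarrow> real) \<Rightarrow> nat set \<Rightarrow> (nat \<Rightarrow> real) \<Rightarrow> real" where
  "mpartial F a I x = (\<Sum>J\<in>{J \<in> F. I \<subseteq> J}. a J * (\<Prod>j\<in>J - I. x j))"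

lemma mpartial_cong:
  assumes "\<And>j. j \<notin> I \<Longrightarrow> x j = y j"
  shows "mpartial F a I x = mpartial F a I y"
  unfolding mpartial_def using assms by (intro sum.cong arg_cong2[where f="(*)"] prod.cong) auto

text \<open>Monomials without the variable i cancel, and the others are linear in it, so the
  difference quotient equals the derivative exactly.\<close>

lemma mpartial_diff:
  assumes F: "finite F" "\<And>J. J \<in> F \<Longrightarrow> finite J" and i: "i \<notin> I"
  shows "mpartial F a I x - mpartial F a I (x(i := y)) = (x i - y) * mpartial F a (insert i I) x"
proof -
  have "mpartial F a I x - mpartial F a I (x(i := y)) =
      (\<Sum>J\<in>{J \<in> F. I \<subseteq> J}. a J * ((\<Prod>j\<in>J - I. x j) - (\<Prod>j\<in>J - I. (x(i := y)) j)))"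
    by (simp only: mpartial_def sum_subtractf[symmetric] right_diff_distrib)
  also have "\<dots> = (\<Sum>J\<in>{J \<in> F. insert i I \<subseteq> J}. (x i - y) * (a J * (\<Prod>j\<in>J - insert i I. x j)))"
  proof (intro sum.mono_neutral_cong_right ballI)
    fix J assume "J \<in> {J \<in> F. I \<subseteq> J} - {J \<in> F. insert i I \<subseteq> J}"
    then have "(\<Prod>j\<in>J - I. (x(i := y)) j) = (\<Prod>j\<in>J - I. x j)"
      by (intro prod.cong) auto
    then show "a J * ((\<Prod>j\<in>J - I. x j) - (\<Prod>j\<in>J - I. (x(i := y)) j)) = 0" by simp
  next
    fix J assume J: "J \<in> {J \<in> F. insert i I \<subseteq> J}"
    then have *: "finite (J - insert i I)" "J - I = insert i (J - insert i I)"
      using F i by auto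
    have "(\<Prod>j\<in>J - insert i I. (x(i := y)) j) = (\<Prod>j\<in>J - insert i I. x j)"
      by (intro prod.cong) auto
    then have "(\<Prod>j\<in>J - I. x j) - (\<Prod>j\<in>J - I. (x(i := y)) j) = (x i - y) * (\<Prod>j\<in>J - insert i I. x j)"
      using *(1) unfolding *(2) by (simp add: left_diff_distrib)
    then show "a J * ((\<Prod>j\<in>J - I. x j) - (\<Prod>j\<in>J - I. (x(i := y)) j)) =
        (x i - y) * (a J * (\<Prod>j\<in>J - insert i I. x j))"
      by simp
  qed (use F in auto)
  finally show ?thesis by (simp add: mpartial_def sum_distrib_left)
qed

text \<open>Induction on the list. As the indices are distinct, replacing coordinate i leaves the
  factors already produced unchanged, and \<open>mpartial_diff\<close> turns the remaining
  difference into one more derivative.\<close>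

lemma prod_Id_minus_T_mpartial:
  assumes F: "finite F" "\<And>J. J \<in> F \<Longrightarrow> finite J" and "distinct is"
  shows "prod_Id_minus_T is (mpartial F a {}) x xb = (\<Prod>i\<in>set is. x i - xb i) * mpartial F a (set is) x"
  using \<open>distinct is\<close>
proof (induction "is" arbitrary: x)
  case (Cons i "is")
  have "prod_Id_minus_T (i # is) (mpartial F a {}) x xb =
      prod_Id_minus_T is (mpartial F a {}) x xb - prod_Id_minus_T is (mpartial F a {}) (x(i := xb i)) xb"
    by (simp add: prod_Id_minus_T_def Id_minus_T_def T_op_def)
  also have "\<dots> = (\<Prod>j\<in>set is. x j - xb j) * mpartial F a (set is) x -
      (\<Prod>j\<in>set is. (x(i := xb i)) j - xb j) * mpartial F a (set is) (x(i := xb i))"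
    using Cons by simp
  also have "(\<Prod>j\<in>set is. (x(i := xb i)) j - xb j) = (\<Prod>j\<in>set is. x j - xb j)"
    using Cons.prems by (intro prod.cong) auto
  also have "(\<Prod>j\<in>set is. x j - xb j) * mpartial F a (set is) x -
      (\<Prod>j\<in>set is. x j - xb j) * mpartial F a (set is) (x(i := xb i)) =
      (\<Prod>j\<in>set is. x j - xb j) * ((x i - xb i) * mpartial F a (insert i (set is)) x)"
    using Cons.prems mpartial_diff[OF F, of i "set is" a x "xb i"]
    by (simp only: right_diff_distrib[symmetric]) simp
  finally show ?case using Cons.prems by simp
qed (simp add: prod_Id_minus_T_def)

lemma f_hom_eq:
  "f_hom n \<alpha> k x = (\<Sum>J | J \<subseteq> {1..n} \<and> card J = k. \<alpha> (sorted_list_of_set J) * (\<Prod>j\<in>J. x j))"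
  unfolding f_hom_def
proof (rule sum.reindex_bij_witness[where i=sorted_list_of_set and j=set])
  fix "is" assume "is \<in> {is. length is = k \<and> set is \<subseteq> {1..n} \<and> sorted_wrt (<) is}"
  then have "is": "length is = k" "set is \<subseteq> {1..n}" "sorted is" "distinct is"
    by (auto simp: strict_sorted_iff)
  then show s: "sorted_list_of_set (set is) = is"
    by (simp add: sorted_list_of_set.idem_if_sorted_distinct)
  show "set is \<in> {J. J \<subseteq> {1..n} \<and> card J = k}"
    using "is" by (simp add: distinct_card)
  show "\<alpha> (sorted_list_of_set (set is)) * (\<Prod>j\<in>set is. x j) = \<alpha> is * prod_list (map x is)"
    using "is" s by (simp add: prod.distinct_set_conv_list)
next
  fix J assume "J \<in> {J. J \<subseteq> {1..n} \<and> card J = k}"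
  then have J: "J \<subseteq> {1..n}" "finite J" "card J = k"
    by (auto intro: finite_subset)
  then show "set (sorted_list_of_set J) = J" by simp
  show "sorted_list_of_set J \<in> {is. length is = k \<and> set is \<subseteq> {1..n} \<and> sorted_wrt (<) is}"
    using J by simp
qed

lemma f_poly_eq_mpartial:
  "f_poly n d \<alpha> = mpartial {J. J \<subseteq> {1..n} \<and> d \<le> card J} (\<lambda>J. \<alpha> (sorted_list_of_set J)) {}"
proof
  fix x
  let ?F = "{J. J \<subseteq> {1..n} \<and> d \<le> card J}"
  let ?t = "\<lambda>J. \<alpha> (sorted_list_of_set J) * (\<Prod>j\<in>J. x j)"
  have "f_poly n d \<alpha> x = (\<Sum>k=d..n. \<Sum>J | J \<in> ?F \<and> card J = k. ?t J)"
    unfolding f_poly_def f_hom_eq by (intro sum.cong) auto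
  also have "\<dots> = (\<Sum>J\<in>?F. ?t J)"
  proof (rule sum.group)
    show "card ` ?F \<subseteq> {d..n}"
      using card_mono[of "{1..n}"] by fastforce
  qed auto
  finally show "f_poly n d \<alpha> x = mpartial ?F (\<lambda>J. \<alpha> (sorted_list_of_set J)) {} x"
    by (simp add: mpartial_def)
qed

section \<open>Essential suprema and comparison of the norms\<close>

lemma esssup_cmult_ennreal_le:
  fixes f :: "'a \<Rightarrow> ennreal"
  assumes [measurable]: "f \<in> borel_measurable M"
  shows "esssup M (\<lambda>x. c * f x) \<le> c * esssup M f"
proof (rule esssup_I)
  show "AE x in M. c * f x \<le> c * esssup M f"
    using esssup_AE[of f M] by eventually_elim (rule mult_left_mono, auto)
qed measurable

text \<open>For positive \<open>c\<close>, the one-sided bound is used for \<open>c\<close> and for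
  its inverse.\<close>

lemma (in prob_space) esssup_cmult_ennreal:
  fixes f :: "'a \<Rightarrow> ennreal"
  assumes [measurable]: "f \<in> borel_measurable M" and "0 \<le> c"
  shows "esssup M (\<lambda>x. ennreal c * f x) = ennreal c * esssup M f"
proof (cases "c = 0")
  case True
  then show ?thesis by (simp add: esssup_const emeasure_space_1)
next
  case False
  then have c: "0 < c" using assms by simp
  have inv: "ennreal c * (ennreal (1 / c) * z) = z" for z
    using c by (simp add: mult.assoc[symmetric] ennreal_mult[symmetric])
  have inv': "ennreal (1 / c) * (ennreal c * z) = z" for z
    using c by (simp add: mult.assoc[symmetric] ennreal_mult[symmetric])
  have "esssup M (\<lambda>x. ennreal (1 / c) * (ennreal c * f x)) \<le> ennreal (1 / c) * esssup M (\<lambda>x. ennreal c * f x)"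
    by (rule esssup_cmult_ennreal_le) measurable
  then have "ennreal c * esssup M f \<le> ennreal c * (ennreal (1 / c) * esssup M (\<lambda>x. ennreal c * f x))"
    unfolding inv' by (rule mult_left_mono) simp
  then show ?thesis
    unfolding inv by (intro antisym esssup_cmult_ennreal_le assms)
qed

lemma ennreal_powr_half_le_1_iff: "ennreal_powr x (1 / 2) \<le> 1 \<longleftrightarrow> x \<le> 1"
proof (cases x)
  case (real r)
  then show ?thesis
    by (simp add: ennreal_powr_def powr_half_sqrt)
qed (simp add: ennreal_powr_def)

lemma ennreal_powr_half_powr_2: "ennreal_powr (ennreal_powr x (1 / 2)) 2 = x"
proof (cases x)
  case (real r)
  then show ?thesis
    by (simp add: ennreal_powr_def powr_powr)
qed (simp add: ennreal_powr_def)

text \<open>The inner square root is undone by the exponent 2, and the outer one does not affect a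
  comparison with 1. Hence only sums of squares need to be integrated.\<close>

lemma Lp_norm_2_le_1_iff:
  "Lp_norm M 2 (\<lambda>\<omega>. HS_norm n k (A \<omega>)) \<le> 1 \<longleftrightarrow>
   (\<integral>\<^sup>+\<omega>. (\<Sum>is | length is = k \<and> set is \<subseteq> {1..n}. (A \<omega> is)\<^sup>2) \<partial>M) \<le> 1"
  by (simp add: Lp_norm_def HS_norm_def ennreal_powr_half_powr_2 ennreal_powr_half_le_1_iff)

text \<open>On a probability space the L^2 norm is at most the L^\<infinity> norm; the conclusion is
  put in the squared form of \<open>Lp_norm_2_le_1_iff\<close>.\<close>

lemma (in prob_space) Lp_norm_infinity_le_1_imp:
  assumes "Lp_norm M \<infinity> (\<lambda>\<omega>. HS_norm n k (A \<omega>)) \<le> 1"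
  shows "(\<integral>\<^sup>+\<omega>. (\<Sum>is | length is = k \<and> set is \<subseteq> {1..n}. (A \<omega> is)\<^sup>2) \<partial>M) \<le> 1"
proof -
  have "AE \<omega> in M. HS_norm n k (A \<omega>) \<le> 1"
    using esssup_AE[of "\<lambda>\<omega>. HS_norm n k (A \<omega>)" M] assms
    by (auto simp: Lp_norm_def elim!: eventually_mono intro: order_trans)
  then have "AE \<omega> in M. (\<Sum>is | length is = k \<and> set is \<subseteq> {1..n}. (A \<omega> is)\<^sup>2) \<le> 1"
    unfolding HS_norm_def ennreal_powr_half_le_1_iff .
  then have "(\<integral>\<^sup>+\<omega>. (\<Sum>is | length is = k \<and> set is \<subseteq> {1..n}. (A \<omega> is)\<^sup>2) \<partial>M) \<le> (\<integral>\<^sup>+\<omega>. 1 \<partial>M)"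
    by (rule nn_integral_mono_AE)
  then show ?thesis by (simp add: emeasure_space_1)
qed

section \<open>Standardized variables with an independent copy\<close>

locale standardized_copy = prob_space M for M :: "'a measure" +
  fixes n :: nat and X Xb :: "nat \<Rightarrow> 'a \<Rightarrow> real"
  assumes n: "1 \<le> n"
    and indep: "indep_vars (\<lambda>_. borel) X {1..n}"
    and copy: "independent_copy M n X Xb"
    and mean: "\<And>i. i \<in> {1..n} \<Longrightarrow> expectation (X i) = 0"
    and second_moment: "\<And>i. i \<in> {1..n} \<Longrightarrow> expectation (\<lambda>\<omega>. (X i \<omega>)\<^sup>2) = 1"
begin

lemma rv_X: "i \<in> {1..n} \<Longrightarrow> random_variable borel (X i)"
  using indep by (auto simp: indep_vars_def)

lemma indep_var_rvec: "indep_var (RR n) (rvec n X) (RR n) (rvec n Xb)"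
  using copy by (simp add: independent_copy_def)

lemma rv_Xb:
  assumes "i \<in> {1..n}" shows "random_variable borel (Xb i)"
proof -
  have "(\<lambda>\<omega>. rvec n Xb \<omega> i) \<in> borel_measurable M"
    using assms indep_var_rv2[OF indep_var_rvec] by (rule measurable_component_singleton[THEN measurable_compose_rev])
  then show ?thesis using assms by (simp add: rvec_def)
qed

lemma distr_Xb:
  assumes i: "i \<in> {1..n}"
  shows "distr M borel (Xb i) = distr M borel (X i)"
proof -
  have comp: "(\<lambda>x. x i) \<in> measurable (RR n) borel"
    using i by (rule measurable_component_singleton)
  have "distr (distr M (RR n) (rvec n Xb)) borel (\<lambda>x. x i) = distr (distr M (RR n) (rvec n X)) borel (\<lambda>x. x i)"
    using copy by (simp add: independent_copy_def)
  then show ?thesis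
    unfolding distr_distr[OF comp indep_var_rv1[OF indep_var_rvec]]
      distr_distr[OF comp indep_var_rv2[OF indep_var_rvec]]
    using i by (simp add: comp_def rvec_def)
qed

text \<open>Independence says that the joint law is the product of the marginals. Both the joint law
  and the marginals are the same for the copy.\<close>

lemma indep_Xb: "indep_vars (\<lambda>_. borel) Xb {1..n}"
proof -
  have "distr M (RR n) (\<lambda>\<omega>. \<lambda>i\<in>{1..n}. Xb i \<omega>) = distr M (RR n) (\<lambda>\<omega>. \<lambda>i\<in>{1..n}. X i \<omega>)"
    using copy by (simp add: independent_copy_def rvec_def[abs_def])
  also have "\<dots> = (\<Pi>\<^sub>M i\<in>{1..n}. distr M borel (X i))"
    using indep n by (subst (asm) indep_vars_iff_distr_eq_PiM') (auto intro: rv_X)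
  also have "\<dots> = (\<Pi>\<^sub>M i\<in>{1..n}. distr M borel (Xb i))"
    by (intro PiM_cong) (auto simp: distr_Xb)
  finally show ?thesis
    using n by (subst indep_vars_iff_distr_eq_PiM') (auto intro: rv_Xb)
qed

lemma indep_X_Xb:
  "indep_vars (\<lambda>_. borel) (\<lambda>(b, i). if b then X i else Xb i) (UNIV \<times> {1..n})"
  using n indep_var_rvec by (intro indep_vars_pair indep indep_Xb) (auto simp: rvec_def[abs_def])

lemma indep_var_X_Xb:
  assumes "i \<in> {1..n}"
  shows "indep_var borel (X i) borel (Xb i)"
proof -
  have "indep_var borel ((\<lambda>x. x i) \<circ> rvec n X) borel ((\<lambda>x. x i) \<circ> rvec n Xb)"
    using assms by (intro indep_var_compose[OF indep_var_rvec]) auto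
  then show ?thesis using assms by (simp add: comp_def rvec_def)
qed

section \<open>Sup norms of products of differences\<close>

text \<open>The normalization 1/2^k of an entry is spread over its k differences; each halved
  difference then has norm at least 1.\<close>

definition diff_norm :: "nat set \<Rightarrow> ennreal" where
  "diff_norm I = esssup M (\<lambda>\<omega>. ennreal \<bar>\<Prod>i\<in>I. (X i \<omega> - Xb i \<omega>) / 2\<bar>)"

text \<open>Independence and equality of laws turn the hypothesis into a bound on the difference of
  two samples of \<open>X i\<close>. Thus \<open>X i\<close> lives on an interval of length
  \<open>D\<close>, to which Popoviciu's inequality applies.\<close>

lemma diff_bound_ge_2:
  assumes i: "i \<in> {1..n}" and D: "AE \<omega> in M. \<bar>X i \<omega> - Xb i \<omega>\<bar> \<le> D"
  shows "2 \<le> D"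
proof -
  note [measurable] = rv_X[OF i] rv_Xb[OF i]
  have "AE \<omega> in M. AE \<omega>' in M. \<bar>X i \<omega> - Xb i \<omega>'\<bar> \<le> D"
    by (rule AE_indep_varD[OF indep_var_X_Xb[OF i] _ D]) measurable
  \<comment> \<open>With the first sample frozen, only the law of \<open>Xb i\<close> matters, and
    it is that of \<open>X i\<close>.\<close>
  then have "AE \<omega> in M. AE \<omega>' in M. \<bar>X i \<omega> - X i \<omega>'\<bar> \<le> D"
  proof eventually_elim
    case (elim \<omega>)
    then have "AE y in distr M borel (Xb i). \<bar>X i \<omega> - y\<bar> \<le> D"
      by (subst AE_distr_iff) auto
    then show ?case
      unfolding distr_Xb[OF i] by (subst (asm) AE_distr_iff) auto
  qed
  then obtain a where "AE \<omega> in M. a \<le> X i \<omega> \<and> X i \<omega> \<le> a + D"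
    by (rule AE_diff_bounded_imp_AE_interval)
  then have "2 \<le> a + D - a"
    by (intro Popoviciu_standardized[of "X i"] mean second_moment i) measurable
  then show ?thesis by simp
qed

text \<open>The two expressions depend on disjoint blocks of the joint independent family
  \<open>indep_X_Xb\<close>.\<close>

lemma indep_var_prod_diff:
  assumes I: "I \<subseteq> {1..n}" and j: "j \<in> {1..n}" "j \<notin> I"
  shows "indep_var borel (\<lambda>\<omega>. \<bar>\<Prod>i\<in>I. (X i \<omega> - Xb i \<omega>) / 2\<bar>)
    borel (\<lambda>\<omega>. X j \<omega> - Xb j \<omega>)"
proof -
  let ?B = "\<lambda>I. UNIV \<times> I :: (bool \<times> nat) set"
  let ?g = "\<lambda>x :: bool \<times> nat \<Rightarrow> real. \<bar>\<Prod>i\<in>I. (x (True, i) - x (False, i)) / 2\<bar>"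
  let ?h = "\<lambda>x :: bool \<times> nat \<Rightarrow> real. x (True, j) - x (False, j)"
  have "indep_var (PiM (?B I) (\<lambda>_. borel)) (\<lambda>\<omega>. restrict (\<lambda>p. (\<lambda>(b, i). if b then X i else Xb i) p \<omega>) (?B I))
      (PiM (?B {j}) (\<lambda>_. borel)) (\<lambda>\<omega>. restrict (\<lambda>p. (\<lambda>(b, i). if b then X i else Xb i) p \<omega>) (?B {j}))"
    by (rule indep_var_restrict[OF indep_X_Xb]) (use I j in auto)
  then have "indep_var borel (?g \<circ> (\<lambda>\<omega>. restrict (\<lambda>p. (\<lambda>(b, i). if b then X i else Xb i) p \<omega>) (?B I)))
      borel (?h \<circ> (\<lambda>\<omega>. restrict (\<lambda>p. (\<lambda>(b, i). if b then X i else Xb i) p \<omega>) (?B {j})))"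
    by (rule indep_var_compose) measurable
  then show ?thesis
    by (simp add: comp_def cong: prod.cong)
qed

text \<open>Let K be the larger norm, assumed finite. Freezing the product over \<open>I\<close> at
  a nonzero value of modulus Y bounds the fresh difference at \<open>j\<close> by 2K/Y almost
  surely. That bound is at least 2 by \<open>diff_bound_ge_2\<close>, whence Y \<le> K.\<close>

lemma diff_norm_insert:
  assumes I: "I \<subseteq> {1..n}" and j: "j \<in> {1..n}" "j \<notin> I"
  shows "diff_norm I \<le> diff_norm (insert j I)"
proof (cases "diff_norm (insert j I)")
  case (real K)
  have "finite I" using I by (rule finite_subset) simp
  have [measurable]: "X i \<in> borel_measurable M" "Xb i \<in> borel_measurable M" if "i \<in> I" for i
    using rv_X[of i] rv_Xb[of i] I that by auto
  let ?Y = "\<lambda>\<omega>. \<bar>\<Prod>i\<in>I. (X i \<omega> - Xb i \<omega>) / 2\<bar>"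
  have "AE \<omega> in M. ennreal \<bar>\<Prod>i\<in>insert j I. (X i \<omega> - Xb i \<omega>) / 2\<bar> \<le> diff_norm (insert j I)"
    unfolding diff_norm_def by (rule esssup_AE)
  then have "AE \<omega> in M. ?Y \<omega> * \<bar>X j \<omega> - Xb j \<omega>\<bar> \<le> 2 * K"
  proof eventually_elim
    case (elim \<omega>)
    then have "\<bar>(X j \<omega> - Xb j \<omega>) / 2 * (\<Prod>i\<in>I. (X i \<omega> - Xb i \<omega>) / 2)\<bar> \<le> K"
      using real j \<open>finite I\<close> by simp
    then show ?case unfolding abs_mult abs_divide by (simp add: mult.commute)
  qed
  then have "AE \<omega> in M. AE \<omega>' in M. ?Y \<omega> * \<bar>X j \<omega>' - Xb j \<omega>'\<bar> \<le> 2 * K"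
    by (rule AE_indep_varD[OF indep_var_prod_diff[OF I j], rotated]) measurable
  then have "AE \<omega> in M. ennreal (?Y \<omega>) \<le> ennreal K"
  proof eventually_elim
    case (elim \<omega>)
    show ?case
    proof (cases "?Y \<omega> = 0")
      case False
      then have pos: "0 < ?Y \<omega>" by (metis abs_ge_zero less_eq_real_def)
      have "2 \<le> 2 * K / ?Y \<omega>"
        using elim by (intro diff_bound_ge_2[OF j(1)], elim eventually_mono)
          (use pos in \<open>simp add: pos_le_divide_eq mult.commute\<close>)
      then show ?thesis
        using pos by (intro ennreal_leI) (simp add: pos_le_divide_eq)
    qed simp
  qed
  then show ?thesis
    unfolding real diff_norm_def[of I] by (intro esssup_I) measurable
qed simp

section \<open>Orthonormality of the monomials\<close>

lemma square_integrable:
  assumes "i \<in> {1..n}"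
  shows "integrable M (\<lambda>\<omega>. (X i \<omega>)\<^sup>2)" "integrable M (X i)"
proof -
  show *: "integrable M (\<lambda>\<omega>. (X i \<omega>)\<^sup>2)"
  proof (rule ccontr)
    assume "\<not> ?thesis"
    then show False
      using second_moment[OF assms] by (simp add: not_integrable_integral_eq)
  qed
  show "integrable M (X i)"
    by (rule square_integrable_imp_integrable[OF rv_X[OF assms] *])
qed

text \<open>The integrand is a product of independent factors 1, \<open>X i\<close> or its square,
  with means 1, 0 and 1. A factor of mean 0 occurs exactly when some index lies in just one of the
  two sets.\<close>

lemma monomials_orthonormal:
  assumes A: "A \<subseteq> {1..n}" and B: "B \<subseteq> {1..n}"
  shows "integrable M (\<lambda>\<omega>. (\<Prod>i\<in>A. X i \<omega>) * (\<Prod>i\<in>B. X i \<omega>))"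
    and "expectation (\<lambda>\<omega>. (\<Prod>i\<in>A. X i \<omega>) * (\<Prod>i\<in>B. X i \<omega>)) = (if A = B then 1 else 0)"
proof -
  define g :: "nat \<Rightarrow> real \<Rightarrow> real" where
    "g i x = (if i \<in> A then x else 1) * (if i \<in> B then x else 1)" for i x
  have prod_eq: "(\<Prod>i\<in>C. X i \<omega>) = (\<Prod>i=1..n. if i \<in> C then X i \<omega> else 1)" if "C \<subseteq> {1..n}" for C \<omega>
    using that by (intro prod.mono_neutral_cong_left) auto
  have eq: "(\<lambda>\<omega>. (\<Prod>i\<in>A. X i \<omega>) * (\<Prod>i\<in>B. X i \<omega>)) = (\<lambda>\<omega>. \<Prod>i=1..n. g i (X i \<omega>))"
    unfolding prod_eq[OF A] prod_eq[OF B] g_def prod.distrib ..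
  have ind: "indep_vars (\<lambda>_. borel) (\<lambda>i \<omega>. g i (X i \<omega>)) {1..n}"
    by (rule indep_vars_compose2[OF indep]) (simp add: g_def)
  have int: "integrable M (\<lambda>\<omega>. g i (X i \<omega>))"
    and exp: "expectation (\<lambda>\<omega>. g i (X i \<omega>)) = (if i \<in> A \<longleftrightarrow> i \<in> B then 1 else 0)" if "i \<in> {1..n}" for i
    using square_integrable[OF that] mean[OF that] second_moment[OF that]
    by (cases "i \<in> A"; cases "i \<in> B"; simp add: g_def power2_eq_square prob_space)+
  show "integrable M (\<lambda>\<omega>. (\<Prod>i\<in>A. X i \<omega>) * (\<Prod>i\<in>B. X i \<omega>))"
    unfolding eq by (rule indep_vars_integrable[OF _ ind int]) auto
  have "expectation (\<lambda>\<omega>. (\<Prod>i\<in>A. X i \<omega>) * (\<Prod>i\<in>B. X i \<omega>)) =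
      (\<Prod>i=1..n. expectation (\<lambda>\<omega>. g i (X i \<omega>)))"
    unfolding eq by (rule indep_vars_lebesgue_integral[OF _ ind int]) auto
  also have "\<dots> = (\<Prod>i=1..n. if i \<in> A \<longleftrightarrow> i \<in> B then 1 else 0)"
    by (rule prod.cong) (use exp in auto)
  also have "\<dots> = (if A = B then 1 else 0)"
  proof (cases "A = B")
    case False
    then obtain i where "i \<in> {1..n}" "\<not> (i \<in> A \<longleftrightarrow> i \<in> B)" using A B by blast
    then show ?thesis using False by (auto intro!: prod_zero bexI[of _ i])
  qed simp
  finally show "expectation (\<lambda>\<omega>. (\<Prod>i\<in>A. X i \<omega>) * (\<Prod>i\<in>B. X i \<omega>)) = (if A = B then 1 else 0)" .
qed

lemma mpartial_rvec:
  assumes "F \<subseteq> Pow {1..n}"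
  shows "mpartial F a I (rvec n X \<omega>) = (\<Sum>J\<in>{J \<in> F. I \<subseteq> J}. a J * (\<Prod>j\<in>J - I. X j \<omega>))"
  unfolding mpartial_def
proof (intro sum.cong arg_cong2[where f="(*)"] prod.cong refl)
  fix J j assume "J \<in> {J \<in> F. I \<subseteq> J}" "j \<in> J - I"
  then have "j \<in> {1..n}" using assms by blast
  then show "rvec n X \<omega> j = X j \<omega>" by (simp add: rvec_def)
qed

lemma measurable_mpartial_rvec:
  assumes "F \<subseteq> Pow {1..n}"
  shows "(\<lambda>\<omega>. mpartial F a I (rvec n X \<omega>)) \<in> borel_measurable M"
  unfolding mpartial_rvec[OF assms]
proof (intro borel_measurable_sum borel_measurable_times borel_measurable_const borel_measurable_prod rv_X)
  fix J j assume "J \<in> {J \<in> F. I \<subseteq> J}" "j \<in> J - I"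
  then show "j \<in> {1..n}" using assms by blast
qed

text \<open>All supports involved contain \<open>I\<close>, so they stay different after
  \<open>I\<close> is removed and the cross terms vanish by orthonormality.\<close>

lemma nn_integral_mpartial_square:
  assumes F: "F \<subseteq> Pow {1..n}"
  shows "(\<integral>\<^sup>+\<omega>. ennreal ((mpartial F a I (rvec n X \<omega>))\<^sup>2) \<partial>M) = (\<Sum>J\<in>{J \<in> F. I \<subseteq> J}. ennreal ((a J)\<^sup>2))"
proof -
  let ?G = "{J \<in> F. I \<subseteq> J}"
  let ?m = "\<lambda>J \<omega>. \<Prod>j\<in>J - I. X j \<omega>"
  have "finite F" using F by (rule finite_subset) simp
  then have fin: "finite ?G" by simp
  have sq: "(mpartial F a I (rvec n X \<omega>))\<^sup>2 = (\<Sum>J\<in>?G. \<Sum>K\<in>?G. a J * a K * (?m J \<omega> * ?m K \<omega>))" for \<omega>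
    unfolding mpartial_rvec[OF F] power2_eq_square sum_product by (simp add: mult_ac)
  have int: "integrable M (\<lambda>\<omega>. a J * a K * (?m J \<omega> * ?m K \<omega>))"
    and exp: "expectation (\<lambda>\<omega>. a J * a K * (?m J \<omega> * ?m K \<omega>)) = (if J = K then (a J)\<^sup>2 else 0)"
    if "J \<in> ?G" "K \<in> ?G" for J K
  proof -
    have JK: "J - I \<subseteq> {1..n}" "K - I \<subseteq> {1..n}" "J - I = K - I \<longleftrightarrow> J = K"
      using that F by auto
    show "integrable M (\<lambda>\<omega>. a J * a K * (?m J \<omega> * ?m K \<omega>))"
      by (intro integrable_mult_right monomials_orthonormal JK)
    show "expectation (\<lambda>\<omega>. a J * a K * (?m J \<omega> * ?m K \<omega>)) = (if J = K then (a J)\<^sup>2 else 0)"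
      using monomials_orthonormal(2)[OF JK(1,2)] JK(3) by (simp add: power2_eq_square)
  qed
  have "(\<integral>\<^sup>+\<omega>. ennreal ((mpartial F a I (rvec n X \<omega>))\<^sup>2) \<partial>M) =
      ennreal (expectation (\<lambda>\<omega>. (mpartial F a I (rvec n X \<omega>))\<^sup>2))"
  proof (rule nn_integral_eq_integral)
    show "integrable M (\<lambda>\<omega>. (mpartial F a I (rvec n X \<omega>))\<^sup>2)"
      unfolding sq by (intro Bochner_Integration.integrable_sum int)
  qed simp
  also have "expectation (\<lambda>\<omega>. (mpartial F a I (rvec n X \<omega>))\<^sup>2) = (\<Sum>J\<in>?G. \<Sum>K\<in>?G. if J = K then (a J)\<^sup>2 else 0)"
    unfolding sq by (simp only: Bochner_Integration.integral_sum Bochner_Integration.integrable_sum int exp cong: sum.cong)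
  also have "\<dots> = (\<Sum>J\<in>?G. (a J)\<^sup>2)"
    using fin by (simp add: sum.delta)
  finally show ?thesis by (simp add: sum_ennreal)
qed

section \<open>Second moments of the hypermatrices\<close>

text \<open>The derivative does not depend on the coordinates in \<open>set is\<close>, so it is
  constant for the essential supremum and can be pulled out.\<close>

lemma h_entry_eq:
  assumes F: "F \<subseteq> Pow {1..n}" and "is": "distinct is" "set is \<subseteq> {1..n}"
  shows "h_entry M n X Xb (mpartial F a {}) is x = ennreal \<bar>mpartial F a (set is) x\<bar> * diff_norm (set is)"
proof -
  have [measurable]: "X i \<in> borel_measurable M" "Xb i \<in> borel_measurable M" if "i \<in> set is" for i
    using rv_X[of i] rv_Xb[of i] "is"(2) that by auto
  \<comment> \<open>The power of 2 compensates for the halved differences in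
    \<open>diff_norm\<close> and cancels against the prefactor of the entry.\<close>
  let ?c = "2 ^ length is * \<bar>mpartial F a (set is) x\<bar>"
  have "prod_Id_minus_T is (mpartial F a {}) (override_on x (rvec n X \<omega>) (set is)) (rvec n Xb \<omega>) =
      (\<Prod>i\<in>set is. X i \<omega> - Xb i \<omega>) * mpartial F a (set is) x" for \<omega>
  proof -
    have "(\<Prod>i\<in>set is. override_on x (rvec n X \<omega>) (set is) i - rvec n Xb \<omega> i) = (\<Prod>i\<in>set is. X i \<omega> - Xb i \<omega>)"
      using "is"(2) by (intro prod.cong) (auto simp: rvec_def)
    moreover have "mpartial F a (set is) (override_on x (rvec n X \<omega>) (set is)) = mpartial F a (set is) x"
      by (rule mpartial_cong) simp
    ultimately show ?thesis
      using F "is"(1) by (subst prod_Id_minus_T_mpartial) (auto intro: finite_subset)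
  qed
  moreover have "(\<Prod>i\<in>set is. X i \<omega> - Xb i \<omega>) = 2 ^ length is * (\<Prod>i\<in>set is. (X i \<omega> - Xb i \<omega>) / 2)" for \<omega>
    using "is"(1) by (simp add: prod_dividef distinct_card)
  ultimately have "h_entry M n X Xb (mpartial F a {}) is x = ennreal (1 / 2 ^ length is) *
      esssup M (\<lambda>\<omega>. ennreal ?c * ennreal \<bar>\<Prod>i\<in>set is. (X i \<omega> - Xb i \<omega>) / 2\<bar>)"
    unfolding h_entry_def by (simp add: ennreal_mult[symmetric] abs_mult mult_ac)
  also have "\<dots> = ennreal (1 / 2 ^ length is) * (ennreal ?c * diff_norm (set is))"
    unfolding diff_norm_def by (subst esssup_cmult_ennreal) auto
  also have "\<dots> = ennreal \<bar>mpartial F a (set is) x\<bar> * diff_norm (set is)"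
    unfolding mult.assoc[symmetric] by (subst ennreal_mult[symmetric]) auto
  finally show ?thesis .
qed

text \<open>This is the weight w_k(J) of the expansion. It runs over lists because the hypermatrix
  has one entry for each ordering of an index set.\<close>

definition diff_weight :: "nat \<Rightarrow> nat set \<Rightarrow> ennreal" where
  "diff_weight k J = (\<Sum>is | length is = k \<and> set is \<subseteq> J \<and> distinct is. (diff_norm (set is))\<^sup>2)"

text \<open>Since k < |J|, every tuple misses some element of \<open>J\<close>; prepending one does
  not lower the norm. The extension is injective, as the tail recovers the tuple, and the longer
  tuples not reached add nonnegative terms.\<close>

lemma diff_weight_Suc:
  assumes J: "J \<subseteq> {1..n}" and k: "k < card J"
  shows "diff_weight k J \<le> diff_weight (Suc k) J"
proof -
  let ?L = "\<lambda>k. {is. length is = k \<and> set is \<subseteq> J \<and> distinct is}"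
  have "finite J" using J by (rule finite_subset) simp
  then have fin: "finite (?L k)" for k
    by (rule finite_subset[OF _ finite_lists_length_eq[of J k], rotated]) auto
  have "\<exists>j. j \<in> J - set is" if "is \<in> ?L k" for "is"
  proof -
    have "card (set is) < card J"
      using that k by (simp add: distinct_card)
    then show ?thesis
      using \<open>finite J\<close> card_mono[of "set is" J] by fastforce
  qed
  then obtain j where j: "\<And>is. is \<in> ?L k \<Longrightarrow> j is \<in> J - set is"
    by metis
  have "diff_weight k J \<le> (\<Sum>is\<in>?L k. (diff_norm (set (j is # is)))\<^sup>2)"
    unfolding diff_weight_def
  proof (intro sum_mono power_mono)
    fix "is" assume "is": "is \<in> ?L k"
    show "diff_norm (set is) \<le> diff_norm (set (j is # is))"
      unfolding list.set using "is" j[OF "is"] J by (intro diff_norm_insert) auto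
  qed simp
  also have "\<dots> = (\<Sum>js\<in>(\<lambda>is. j is # is) ` ?L k. (diff_norm (set js))\<^sup>2)"
    by (subst sum.reindex) (auto simp: inj_on_def)
  also have "\<dots> \<le> diff_weight (Suc k) J"
    unfolding diff_weight_def using fin j by (intro sum_mono2) auto
  finally show ?thesis .
qed

lemma diff_weight_mono:
  assumes J: "J \<subseteq> {1..n}" and "k \<le> d" "d \<le> card J"
  shows "diff_weight k J \<le> diff_weight d J"
  using assms(2,3)
proof (induction d rule: dec_induct)
  case (step m)
  then show ?case using diff_weight_Suc[OF J, of m] by simp
qed simp

text \<open>Each squared entry integrates to a sum over the supports that contain its indices.
  Exchanging the sums collects, for each support, the tuples inside it.\<close>

lemma nn_integral_h_hypermatrix:
  assumes F: "F \<subseteq> Pow {1..n}"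
  shows "(\<integral>\<^sup>+\<omega>. (\<Sum>is | length is = k \<and> set is \<subseteq> {1..n}.
      (h_hypermatrix M n X Xb (mpartial F a {}) (rvec n X \<omega>) is)\<^sup>2) \<partial>M) =
    (\<Sum>J\<in>F. ennreal ((a J)\<^sup>2) * diff_weight k J)"
proof -
  let ?L = "{is. length is = k \<and> set is \<subseteq> {1..n} \<and> distinct is}"
  have finL0: "finite {is. length is = k \<and> set is \<subseteq> {1..n}}"
    by (rule finite_subset[OF _ finite_lists_length_eq[of "{1..n}" k]]) auto
  have finL: "finite ?L"
    by (rule finite_subset[OF _ finL0]) auto
  have finF: "finite F" using F by (rule finite_subset) simp
  have "(\<Sum>is | length is = k \<and> set is \<subseteq> {1..n}.
        (h_hypermatrix M n X Xb (mpartial F a {}) (rvec n X \<omega>) is)\<^sup>2) =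
      (\<Sum>is\<in>?L. (diff_norm (set is))\<^sup>2 * ennreal ((mpartial F a (set is) (rvec n X \<omega>))\<^sup>2))" for \<omega>
  proof (rule sum.mono_neutral_cong_right[OF finL0])
    fix "is" assume "is \<in> ?L"
    then show "(h_hypermatrix M n X Xb (mpartial F a {}) (rvec n X \<omega>) is)\<^sup>2 =
        (diff_norm (set is))\<^sup>2 * ennreal ((mpartial F a (set is) (rvec n X \<omega>))\<^sup>2)"
      by (simp add: h_hypermatrix_def h_entry_eq[OF F] power_mult_distrib ennreal_power mult.commute)
  \<comment> \<open>Tuples with a repeated index contribute 0.\<close>
  qed (auto simp: h_hypermatrix_def)
  then have "(\<integral>\<^sup>+\<omega>. (\<Sum>is | length is = k \<and> set is \<subseteq> {1..n}.
        (h_hypermatrix M n X Xb (mpartial F a {}) (rvec n X \<omega>) is)\<^sup>2) \<partial>M) =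
      (\<Sum>is\<in>?L. (diff_norm (set is))\<^sup>2 * (\<Sum>J\<in>{J \<in> F. set is \<subseteq> J}. ennreal ((a J)\<^sup>2)))"
    using measurable_mpartial_rvec[OF F]
    by (simp add: nn_integral_sum nn_integral_cmult nn_integral_mpartial_square[OF F])
  also have "\<dots> = (\<Sum>is\<in>?L. \<Sum>J\<in>{J \<in> F. set is \<subseteq> J}. ennreal ((a J)\<^sup>2) * (diff_norm (set is))\<^sup>2)"
    by (simp add: sum_distrib_left mult.commute del: sum_ennreal)
  also have "\<dots> = (\<Sum>J\<in>F. \<Sum>is\<in>{is \<in> ?L. set is \<subseteq> J}. ennreal ((a J)\<^sup>2) * (diff_norm (set is))\<^sup>2)"
    by (rule sum.swap_restrict[OF finL finF])
  also have "\<dots> = (\<Sum>J\<in>F. ennreal ((a J)\<^sup>2) * diff_weight k J)"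
    unfolding diff_weight_def sum_distrib_left using F by (intro sum.cong) auto
  finally show ?thesis .
qed

end

section \<open>Comparison of the levels\<close>

theorem proposition1p2:
  fixes M :: "'a measure" and n d :: nat
    and X Xb :: "nat \<Rightarrow> 'a \<Rightarrow> real" and \<alpha> :: "nat list \<Rightarrow> real"
  assumes "prob_space M"
    and "1 \<le> d" and "d \<le> n"
    and "prob_space.indep_vars M (\<lambda>_. borel) X {1..n}"
    and "independent_copy M n X Xb"
    and "\<And>i. i \<in> {1..n} \<Longrightarrow> \<exists>B. AE \<omega> in M. \<bar>X i \<omega>\<bar> \<le> B"
    and "\<And>i. i \<in> {1..n} \<Longrightarrow> prob_space.expectation M (X i) = 0"
    and "\<And>i. i \<in> {1..n} \<Longrightarrow> prob_space.expectation M (\<lambda>\<omega>. (X i \<omega>)\<^sup>2) = 1"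
    and "h_HS_norm M n X Xb (f_poly n d \<alpha>) d \<infinity> \<le> 1"
  shows "\<forall>k\<in>{1..d - 1}. h_HS_norm M n X Xb (f_poly n d \<alpha>) k 2 \<le> 1"
proof
  interpret prob_space M by fact
  interpret standardized_copy M n X Xb
    by unfold_locales (use assms in auto)
  define F where "F = {J. J \<subseteq> {1..n} \<and> d \<le> card J}"
  define a where "a = (\<lambda>J. \<alpha> (sorted_list_of_set J))"
  have F: "F \<subseteq> Pow {1..n}" by (auto simp: F_def)
  have f: "f_poly n d \<alpha> = mpartial F a {}"
    unfolding F_def a_def by (rule f_poly_eq_mpartial)
  fix k assume k: "k \<in> {1..d - 1}"
  \<comment> \<open>The lowest degree of \<open>f_poly\<close> enters here: every support J in
    \<open>F\<close> satisfies k \<le> d \<le> |J|, so \<open>diff_weight_mono\<close> applies term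
    by term.\<close>
  have "(\<Sum>J\<in>F. ennreal ((a J)\<^sup>2) * diff_weight k J) \<le> (\<Sum>J\<in>F. ennreal ((a J)\<^sup>2) * diff_weight d J)"
    by (intro sum_mono mult_left_mono diff_weight_mono) (use k in \<open>auto simp: F_def\<close>)
  \<comment> \<open>The right-hand sum is the integrated sum of squares at level \<open>d\<close>,
    which the assumed L^\<infinity> bound controls.\<close>
  also have "\<dots> \<le> 1"
    using Lp_norm_infinity_le_1_imp[OF assms(9)[unfolded h_HS_norm_def f]]
    unfolding nn_integral_h_hypermatrix[OF F] .
  finally show "h_HS_norm M n X Xb (f_poly n d \<alpha>) k 2 \<le> 1"
    unfolding h_HS_norm_def f Lp_norm_2_le_1_iff nn_integral_h_hypermatrix[OF F] .
qed

end
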